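(* Let $f:\mathbb{C}\to\widehat{\mathbb{C}}$ be a transcendental entire or transcendental meromorphic function. If $a\in\widehat{\mathbb{C}}$ is the Baker omitted value of $f$, then $a$ is the only asymptotic value of $f$.
   Context: $\widehat{\mathbb{C}}=\mathbb{C}\cup\{\infty\}$, and $D_r(a)$ is the open ball centered at $a\in\widehat{\mathbb{C}}$ with radius $r$ with respect to the spherical metric. Functions have a single essential singularity, located at $\infty$. A point $a\in\widehat{\mathbb{C}}$ is an omitted value of $f$ if $f(z)\neq a$ for every $z\in\mathbb{C}$. An omitted value $a\in\widehat{\mathbb{C}}$ of $f$ is a Baker omitted value (bov) if there exists $r_0>0$ such that for all $r$ with $0<r<r_0$, each component of the boundary of $f^{-1}(D_r(a))$ (boundary taken in $\mathbb{C}$) is bounded. A point $b\in\widehat{\mathbb{C}}$ is an asymptotic value of $f$ if there is a curve $\gamma:[0,\infty)\to\mathbb{C}$ with $\lim_{t\to\infty}\gamma(t)=\infty$ and $\lim_{t\to\infty}f(\gamma(t))=b$. *)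

theory Defs
  imports "HOL-Complex_Analysis.Complex_Analysis"
begin

datatype riemann_sphere = Finite_pt complex | Infinity_pt

text \<open>
  Inverse stereographic projection from the north pole onto the unit sphere of
  \<open>complex \<times> real\<close>. The spherical metric is the geodesic (great-circle) distance, which is the
  one induced by \<open>2|dz|/(1+|z|\<^sup>2)\<close>.
\<close>

primrec sphere_embed :: "riemann_sphere \<Rightarrow> complex \<times> real" where
  "sphere_embed (Finite_pt z) =
     (complex_of_real (2 / (1 + (norm z)\<^sup>2)) * z, ((norm z)\<^sup>2 - 1) / ((norm z)\<^sup>2 + 1))"
| "sphere_embed Infinity_pt = (0, 1)"

lemma norm_sphere_embed [simp]: "norm (sphere_embed x) = 1"
proof (cases x)
  case (Finite_pt z)
  define s where "s = (norm z)\<^sup>2"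
  have s: "1 + s > 0" unfolding s_def by (simp add: add_pos_nonneg)
  have "norm (complex_of_real (2 / (1 + s)) * z) = 2 / (1 + s) * norm z"
    using s by (simp add: norm_mult norm_divide del: of_real_divide of_real_add)
  hence n: "(norm (complex_of_real (2 / (1 + s)) * z))\<^sup>2 = (2 / (1 + s))\<^sup>2 * s"
    by (simp only: power_mult_distrib s_def)
  have "(2 / (1 + s))\<^sup>2 * s + ((s - 1) / (s + 1))\<^sup>2 = (4 * s + (s - 1)\<^sup>2) / (1 + s)\<^sup>2"
    by (simp add: power_divide add_divide_distrib add.commute)
  also have "4 * s + (s - 1)\<^sup>2 = (1 + s)\<^sup>2"
    by (simp add: power2_eq_square algebra_simps)
  also have "(1 + s)\<^sup>2 / (1 + s)\<^sup>2 = 1"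
    using s by simp
  finally show ?thesis
    using n unfolding Finite_pt sphere_embed.simps norm_Pair s_def[symmetric]
      real_norm_def power2_abs by simp
qed (simp add: norm_Pair)

lemma sphere_embed_inject: "sphere_embed x = sphere_embed y \<longleftrightarrow> x = y"
proof
  assume eq: "sphere_embed x = sphere_embed y"
  have snd_eq: "snd (sphere_embed (Finite_pt z)) = 1 - 2 / (1 + (norm z)\<^sup>2)" for z
  proof -
    have "1 + (norm z)\<^sup>2 \<noteq> 0"
      by (smt (verit) zero_le_power2)
    thus ?thesis by (simp add: field_simps)
  qed
  have pos: "2 / (1 + (norm z)\<^sup>2) > 0" for z :: complex
    by (simp add: add_pos_nonneg)
  show "x = y"
  proof (cases x; cases y)
    fix z w assume xy: "x = Finite_pt z" "y = Finite_pt w"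
    have "2 / (1 + (norm z)\<^sup>2) = 2 / (1 + (norm w)\<^sup>2)"
      using snd_eq[of z] snd_eq[of w] eq xy by simp
    moreover have "complex_of_real (2 / (1 + (norm z)\<^sup>2)) * z
                     = complex_of_real (2 / (1 + (norm w)\<^sup>2)) * w"
      using eq xy by simp
    ultimately show ?thesis
      using pos[of w] xy by (metis less_irrefl mult_left_cancel of_real_eq_0_iff)
  next
    fix z assume "x = Finite_pt z" "y = Infinity_pt"
    thus ?thesis using eq snd_eq[of z] pos[of z] by simp
  next
    fix z assume "x = Infinity_pt" "y = Finite_pt z"
    thus ?thesis using eq snd_eq[of z] pos[of z] by simp
  qed simp
qed simp

lemma arccos_inner_triangle:
  fixes u v w :: "'a :: real_inner"
  assumes u: "norm u = 1" and v: "norm v = 1" and w: "norm w = 1"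
  shows "arccos (inner u w) \<le> arccos (inner u v) + arccos (inner v w)"
proof -
  have unit: "inner u u = 1" "inner v v = 1" "inner w w = 1"
    using u v w by (simp_all add: dot_square_norm)
  have bd: "\<bar>inner u w\<bar> \<le> 1" "\<bar>inner u v\<bar> \<le> 1" "\<bar>inner v w\<bar> \<le> 1"
    using Cauchy_Schwarz_ineq2[of u w] Cauchy_Schwarz_ineq2[of u v] Cauchy_Schwarz_ineq2[of v w]
    by (simp_all add: u v w)
  define a b where "a = inner u v" and "b = inner v w"
  define \<alpha> \<beta> where "\<alpha> = arccos a" and "\<beta> = arccos b"
  have ab: "-1 \<le> a" "a \<le> 1" "-1 \<le> b" "b \<le> 1"
    using bd by (auto simp: a_def b_def abs_le_iff)
  have rng: "0 \<le> \<alpha>" "\<alpha> \<le> pi" "0 \<le> \<beta>" "\<beta> \<le> pi"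
    using ab by (auto simp: \<alpha>_def \<beta>_def arccos_lbound arccos_ubound)
  show ?thesis
  proof (cases "\<alpha> + \<beta> \<le> pi")
    case False
    thus ?thesis using arccos_ubound[of "inner u w"] bd
      by (auto simp: \<alpha>_def \<beta>_def a_def b_def abs_le_iff)
  next
    case True
    define p q where "p = u - a *\<^sub>R v" and "q = w - b *\<^sub>R v"
    have pq: "inner p q = inner u w - a * b"
      using unit by (simp add: p_def q_def a_def b_def inner_diff_left inner_diff_right
          inner_commute algebra_simps)
    have pp: "norm p = sqrt (1 - a\<^sup>2)"
      using unit by (simp add: norm_eq_sqrt_inner p_def a_def inner_diff_left inner_diff_right
          inner_commute algebra_simps power2_eq_square)
    have qq: "norm q = sqrt (1 - b\<^sup>2)"
      using unit by (simp add: norm_eq_sqrt_inner q_def b_def inner_diff_left inner_diff_right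
          inner_commute algebra_simps power2_eq_square)
    have "cos (\<alpha> + \<beta>) = a * b - sqrt (1 - a\<^sup>2) * sqrt (1 - b\<^sup>2)"
      using ab by (simp add: cos_add \<alpha>_def \<beta>_def sin_arccos)
    also have "\<dots> \<le> inner u w"
      using Cauchy_Schwarz_ineq2[of p q] unfolding pq pp qq by linarith
    finally have "cos (\<alpha> + \<beta>) \<le> inner u w" .
    hence "arccos (inner u w) \<le> arccos (cos (\<alpha> + \<beta>))"
      using bd by (intro arccos_le_arccos) auto
    also have "\<dots> = \<alpha> + \<beta>"
      using rng True by (intro arccos_cos) auto
    finally show ?thesis by (simp add: \<alpha>_def \<beta>_def a_def b_def)
  qed
qed

instantiation riemann_sphere :: metric_space
begin

definition dist_riemann_sphere :: "riemann_sphere \<Rightarrow> riemann_sphere \<Rightarrow> real" where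
  "dist x y = arccos (inner (sphere_embed x) (sphere_embed y))"

definition uniformity_riemann_sphere :: "(riemann_sphere \<times> riemann_sphere) filter" where
  "uniformity_riemann_sphere = (INF e\<in>{0<..}. principal {(x, y). dist x y < e})"

definition open_riemann_sphere :: "riemann_sphere set \<Rightarrow> bool" where
  "open_riemann_sphere U \<longleftrightarrow>
     (\<forall>x\<in>U. eventually (\<lambda>(x', y). x' = x \<longrightarrow> y \<in> U) uniformity)"

instance
proof
  fix x y z :: riemann_sphere
  let ?e = sphere_embed
  have unit: "inner (?e x) (?e x) = 1" for x
    by (simp add: dot_square_norm)
  have bd: "\<bar>inner (?e x) (?e y)\<bar> \<le> 1" for x y
    using Cauchy_Schwarz_ineq2[of "?e x" "?e y"] by simp
  show "dist x y = 0 \<longleftrightarrow> x = y"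
  proof
    assume "dist x y = 0"
    hence "inner (?e x) (?e y) = 1"
      using bd[of x y] cos_arccos_abs[of "inner (?e x) (?e y)"]
      by (simp add: dist_riemann_sphere_def)
    hence "inner (?e x - ?e y) (?e x - ?e y) = 0"
      using unit by (simp add: inner_diff_left inner_diff_right inner_commute)
    thus "x = y" by (simp add: sphere_embed_inject)
  qed (simp add: dist_riemann_sphere_def unit)
  show "dist x y \<le> dist x z + dist y z"
    using arccos_inner_triangle[of "?e x" "?e z" "?e y"]
    by (simp add: dist_riemann_sphere_def inner_commute)
qed (simp_all add: uniformity_riemann_sphere_def open_riemann_sphere_def)

end

text \<open>
  A meromorphic function in the plane, regarded as a map into the sphere, takes the value
  \<open>Infinity_pt\<close> exactly at its poles. \<open>nicely_meromorphic_on\<close> rules out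
  removable singularities with a wrong value. Poles are allowed but not required.
\<close>

definition meromorphic_map :: "(complex \<Rightarrow> riemann_sphere) \<Rightarrow> bool" where
  "meromorphic_map f \<longleftrightarrow>
     (\<exists>g. g nicely_meromorphic_on UNIV \<and>
          (\<forall>z. f z = (if is_pole g z then Infinity_pt else Finite_pt (g z))))"

definition entire_map :: "(complex \<Rightarrow> riemann_sphere) \<Rightarrow> bool" where
  "entire_map f \<longleftrightarrow> (\<exists>g. g holomorphic_on UNIV \<and> (\<forall>z. f z = Finite_pt (g z)))"

text \<open>
  For \<open>f\<close> meromorphic in the plane, agreement with \<open>p / q\<close> off the zeros of \<open>q\<close>
  determines \<open>f\<close> everywhere; \<open>f\<close> not being rational means that
  infinity is an essential singularity.
\<close>

definition rational_map :: "(complex \<Rightarrow> riemann_sphere) \<Rightarrow> bool" where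
  "rational_map f \<longleftrightarrow>
     (\<exists>p q. q \<noteq> 0 \<and> (\<forall>z. poly q z \<noteq> 0 \<longrightarrow> f z = Finite_pt (poly p z / poly q z)))"

definition transcendental_entire :: "(complex \<Rightarrow> riemann_sphere) \<Rightarrow> bool" where
  "transcendental_entire f \<longleftrightarrow> entire_map f \<and> \<not> rational_map f"

definition transcendental_meromorphic :: "(complex \<Rightarrow> riemann_sphere) \<Rightarrow> bool" where
  "transcendental_meromorphic f \<longleftrightarrow> meromorphic_map f \<and> \<not> rational_map f"

definition omitted_value :: "(complex \<Rightarrow> riemann_sphere) \<Rightarrow> riemann_sphere \<Rightarrow> bool" where
  "omitted_value f a \<longleftrightarrow> (\<forall>z. f z \<noteq> a)"

definition baker_omitted_value :: "(complex \<Rightarrow> riemann_sphere) \<Rightarrow> riemann_sphere \<Rightarrow> bool" where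
  "baker_omitted_value f a \<longleftrightarrow> omitted_value f a \<and>
     (\<exists>r0>0. \<forall>r. 0 < r \<and> r < r0 \<longrightarrow>
        (\<forall>C \<in> components (frontier (f -` ball a r)). bounded C))"

definition asymptotic_value :: "(complex \<Rightarrow> riemann_sphere) \<Rightarrow> riemann_sphere \<Rightarrow> bool" where
  "asymptotic_value f b \<longleftrightarrow>
     (\<exists>\<gamma> :: real \<Rightarrow> complex. continuous_on {0..} \<gamma> \<and> filterlim \<gamma> at_infinity at_top \<and>
        ((\<lambda>t. f (\<gamma> t)) \<longlongrightarrow> b) at_top)"

end

theory Submission imports Defs begin

text \<open>
  After a rotation of the sphere the omitted value is infinity and the map is an entire function
  \<open>h\<close>, so the preimages of small discs about \<open>a\<close> are the superlevel sets
  \<open>{|h| > R}\<close>. These are nonempty by Liouville, and each of their components \<open>V\<close> is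
  unbounded by the maximum principle. A component of the complement of \<open>V\<close> has connected
  boundary by unicoherence of the plane. This boundary lies in the boundary of the superlevel set,
  so it is bounded for a Baker omitted value, and hence the component itself is bounded. Thus every
  connected set avoiding \<open>V\<close> is bounded. It follows that each preimage is connected, so
  joining points of smaller and smaller preimages gives a curve along which the map tends to
  \<open>a\<close>. It also follows that no curve to infinity eventually avoids such a preimage, so
  there is no other asymptotic value.
\<close>

section \<open>Topology of open sets whose boundary components are bounded\<close>

lemma connected_disjoint_unbounded_component_imp_bounded:
  fixes U :: "'a::euclidean_space set"
  assumes dim: "2 \<le> DIM('a)"
    and fr: "\<And>C. C \<in> components (frontier U) \<Longrightarrow> bounded C"
    and V: "V \<in> components U" "\<not> bounded V"
    and T: "connected T" "T \<inter> V = {}"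
  shows "bounded T"
proof (cases "T = {}")
  case False
  obtain C where C: "C \<in> components (- V)" "T \<subseteq> C"
    using exists_component_superset[of T "- V"] T False by auto
  have "connected (frontier C)"
    using connected_frontier_component_complement C(1) V(1) in_components_connected by blast
  moreover have "frontier C \<subseteq> frontier U"
    using frontier_of_components_subset[OF C(1)] frontier_of_components_subset[OF V(1)]
    by (simp add: frontier_complement)
  ultimately have "bounded (frontier C)"
    using fr exists_component_superset[of "frontier C" "frontier U"]
    by (metis bounded_empty bounded_subset)
  then obtain B where B: "frontier C \<subseteq> ball 0 B"
    using bounded_subset_ballD by blast
  \<comment> \<open>In dimension at least 2 the outside of a large ball is connected. Missing
    \<open>frontier C\<close>, it lies wholly inside or wholly outside \<open>C\<close>; the former
    would trap the unbounded \<open>V\<close> in the ball.\<close>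
  have "connected (- ball 0 B :: 'a set)"
    by (rule connected_complement_bounded_convex) (use dim in auto)
  moreover have "- ball 0 B \<inter> frontier C = {}"
    using B by auto
  ultimately have "- ball 0 B \<inter> C = {} \<or> - ball 0 B - C = {}"
    using connected_Int_frontier by blast
  moreover have "- ball 0 B - C \<noteq> {}"
  proof
    assume "- ball 0 B - C = {}"
    hence "V \<subseteq> ball 0 B"
      using in_components_subset[OF C(1)] by blast
    thus False using V(2) bounded_ball bounded_subset by blast
  qed
  ultimately have "T \<subseteq> ball 0 B"
    using C(2) by blast
  thus ?thesis using bounded_ball bounded_subset by blast
qed simp

text \<open>A second component would be a connected set avoiding the first, unbounded one, and hence
  bounded by the preceding lemma.\<close>

lemma connected_if_components_unbounded:
  fixes U :: "'a::euclidean_space set"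
  assumes "2 \<le> DIM('a)"
    and "\<And>C. C \<in> components (frontier U) \<Longrightarrow> bounded C"
    and "\<And>V. V \<in> components U \<Longrightarrow> \<not> bounded V"
  shows "connected U"
  unfolding connected_iff_eq_connected_component_set
proof
  fix x assume x: "x \<in> U"
  let ?X = "connected_component_set U x"
  have "y \<in> ?X" if "y \<in> U" for y
  proof (rule ccontr)
    assume y: "y \<notin> ?X"
    let ?Y = "connected_component_set U y"
    have X: "?X \<in> components U" and Y: "?Y \<in> components U"
      using x that by (auto simp: components_def)
    have "?Y \<inter> ?X = {}"
      using y that components_nonoverlap[OF Y X] connected_component_refl_eq by fastforce
    hence "bounded ?Y"
      using connected_disjoint_unbounded_component_imp_bounded[OF assms(1,2) X assms(3)[OF X]]
      by simp
    thus False using assms(3) Y by blast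
  qed
  thus "?X = U" using connected_component_subset by blast
qed

section \<open>Superlevel sets of entire functions\<close>

lemma superlevel_component_unbounded:
  fixes h :: "complex \<Rightarrow> complex"
  assumes h: "h holomorphic_on UNIV" and V: "V \<in> components {z. R < norm (h z)}"
  shows "\<not> bounded V"
proof
  assume bd: "bounded V"
  let ?U = "{z. R < norm (h z)}"
  have cont: "continuous_on UNIV h"
    using h holomorphic_on_imp_continuous_on by blast
  have U: "open ?U"
    by (intro open_Collect_less continuous_intros continuous_on_subset[OF cont]) auto
  \<comment> \<open>The superlevel set is open, so it contains none of its own frontier points, and
    these include the frontier of \<open>V\<close>.\<close>
  have fr: "norm (h z) \<le> R" if "z \<in> frontier V" for z
    using that frontier_of_components_subset[OF V] interior_open[OF U]
    by (auto simp: frontier_def)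
  obtain z where z: "z \<in> V" using V in_components_nonempty by blast
  have "norm (h z) \<le> R"
    by (rule maximum_modulus_frontier[of h V])
       (use h cont bd fr z in \<open>auto intro: holomorphic_on_subset continuous_on_subset\<close>)
  moreover have "z \<in> ?U" using V z in_components_subset by blast
  ultimately show False by simp
qed

lemma superlevel_nonempty:
  fixes h :: "complex \<Rightarrow> complex"
  assumes "h holomorphic_on UNIV" "\<not> h constant_on UNIV"
  shows "\<exists>z. R < norm (h z)"
proof (rule ccontr)
  assume "\<not> ?thesis"
  hence "bounded (range h)"
    by (auto simp: bounded_iff not_less)
  thus False using Liouville_theorem assms by blast
qed

text \<open>Nestedness puts the chosen points of \<open>U n\<close> and \<open>U (Suc n)\<close>
  both in \<open>U n\<close>, where a path joins them; these paths are run one after another, each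
  in unit time.\<close>

lemma path_through_nested_open_sets:
  fixes U :: "nat \<Rightarrow> 'a::euclidean_space set"
  assumes op: "\<And>n. open (U n)" and con: "\<And>n. connected (U n)"
    and ne: "\<And>n. U n \<noteq> {}" and dec: "decseq U"
  obtains \<gamma> :: "real \<Rightarrow> 'a"
  where "continuous_on {0..} \<gamma>" "\<And>n t. real n \<le> t \<Longrightarrow> \<gamma> t \<in> U n"
proof -
  have "\<exists>x. x \<in> U n" for n using ne by blast
  then obtain x where x: "x n \<in> U n" for n by metis
  have "\<exists>p. path p \<and> path_image p \<subseteq> U n \<and> pathstart p = x n \<and> pathfinish p = x (Suc n)" for n
  proof -
    have "path_connected (U n)"
      using op con by (simp add: connected_open_path_connected)
    moreover have "x (Suc n) \<in> U n"
      using x[of "Suc n"] decseq_SucD[OF dec] by blast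
    ultimately show ?thesis using x[of n] unfolding path_connected_def by blast
  qed
  then obtain p where p: "path (p n)" "path_image (p n) \<subseteq> U n"
    "pathstart (p n) = x n" "pathfinish (p n) = x (Suc n)" for n
    by metis
  define \<gamma> where "\<gamma> t = p (nat \<lfloor>t\<rfloor>) (t - real (nat \<lfloor>t\<rfloor>))" for t
  have on_piece: "\<gamma> t = p n (t - real n)" if t: "real n \<le> t" "t \<le> real (Suc n)" for n t
  \<comment> \<open>At the right endpoint the floor has already jumped, so \<open>\<gamma>\<close>
    reads the start of the next path, which is the end of \<open>p n\<close>.\<close>
  proof (cases "t = real (Suc n)")
    case True
    thus ?thesis using p(3)[of "Suc n"] p(4)[of n]
      by (simp add: \<gamma>_def pathstart_def pathfinish_def del: of_nat_Suc) simp
  next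
    case False
    hence "\<lfloor>t\<rfloor> = int n" using t by (intro floor_unique) auto
    thus ?thesis by (simp add: \<gamma>_def)
  qed
  have piece: "continuous_on {real n..real (Suc n)} \<gamma>" for n
  proof -
    have "continuous_on {real n..real (Suc n)} (\<lambda>t. p n (t - real n))"
      by (rule continuous_on_compose2[OF p(1)[of n, unfolded path_def]])
         (auto intro!: continuous_intros)
    thus ?thesis by (rule continuous_on_eq) (use on_piece in auto)
  qed
  have initial: "continuous_on {0..real n} \<gamma>" for n
  proof (induction n)
    case (Suc n)
    have "{0..real (Suc n)} = {0..real n} \<union> {real n..real (Suc n)}" by auto
    thus ?case using continuous_on_closed_Un[OF _ _ Suc piece[of n]] by simp
  qed simp
  have "continuous_on {0..} \<gamma>"
    unfolding continuous_on_eq_continuous_within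
  proof
    fix t :: real assume t: "t \<in> {0..}"
    obtain n where n: "t < real n" using reals_Archimedean2 by blast
    have "at t within {0..} = at t within {0..real n}"
      by (rule at_within_nhd[of _ "{..<real n}"]) (use n in auto)
    thus "continuous (at t within {0..}) \<gamma>"
      using initial[of n] n t by (simp add: continuous_on_eq_continuous_within)
  qed
  moreover have "\<gamma> t \<in> U n" if "real n \<le> t" for n t
  proof -
    let ?m = "nat \<lfloor>t\<rfloor>"
    have "0 \<le> t" using that by linarith
    hence "t - real ?m \<in> {0..1}" by (auto; linarith)
    hence "\<gamma> t \<in> U ?m" using p(2)[of ?m] by (auto simp: \<gamma>_def path_image_def)
    moreover have "n \<le> ?m" using that by (simp add: le_nat_floor)
    ultimately show ?thesis using decseqD[OF dec] by blast
  qed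
  ultimately show ?thesis using that by blast
qed

section \<open>Spherical distance to infinity and rotations of the sphere\<close>

lemma dist_Finite_Infinity:
  "dist (Finite_pt w) Infinity_pt = arccos (((norm w)\<^sup>2 - 1) / ((norm w)\<^sup>2 + 1))"
  by (simp add: dist_riemann_sphere_def)

text \<open>Since \<open>arccos\<close> is decreasing, the condition becomes a lower bound
  \<open>cos r\<close> on the height on the sphere, to be solved for the modulus. This turns
  preimages of discs about infinity into superlevel sets.\<close>

lemma dist_Infinity_less_iff:
  assumes "0 < r" "r < pi"
  shows "dist (Finite_pt w) Infinity_pt < r \<longleftrightarrow> sqrt ((1 + cos r) / (1 - cos r)) < norm w"
proof -
  define W where "W = (norm w)\<^sup>2"
  have W: "0 \<le> W" by (simp add: W_def)
  have cosr: "cos r < 1" using cos_monotone_0_pi[of 0 r] assms by simp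
  have q: "\<bar>(W - 1) / (W + 1)\<bar> \<le> 1" using W by (simp add: abs_if field_simps)
  have "dist (Finite_pt w) Infinity_pt < r \<longleftrightarrow> arccos ((W - 1) / (W + 1)) < arccos (cos r)"
    using assms by (simp add: dist_Finite_Infinity W_def arccos_cos)
  also have "\<dots> \<longleftrightarrow> cos r < (W - 1) / (W + 1)"
    using q by (intro arccos_less_mono) auto
  also have "\<dots> \<longleftrightarrow> (1 + cos r) / (1 - cos r) < W"
    using W cosr by (simp add: field_simps)
  also have "\<dots> \<longleftrightarrow> sqrt ((1 + cos r) / (1 - cos r)) < sqrt W"
    by simp
  finally show ?thesis by (simp add: W_def)
qed

text \<open>
  The point on the right is \<open>(1 + cnj c * w) / (w - c)\<close>, the image of \<open>w\<close>
  under a rotation of the sphere taking \<open>c\<close> to infinity; the form used here shows that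
  infinity goes to \<open>cnj c\<close>.
\<close>

lemma dist_Finite_eq_rotated:
  assumes "w \<noteq> c"
  shows "dist (Finite_pt w) (Finite_pt c) =
    dist (Finite_pt (cnj c + complex_of_real (1 + (norm c)\<^sup>2) / (w - c))) Infinity_pt"
proof -
  define W C d D where "W = (norm w)\<^sup>2" and "C = (norm c)\<^sup>2" and "d = inner w c"
    and "D = (norm (w - c))\<^sup>2"
  let ?h = "cnj c + complex_of_real (1 + C) / (w - c)"
  have pos: "0 < 1 + W" "0 < 1 + C" "0 < D"
    using assms by (auto simp: W_def C_def D_def add_pos_nonneg)
  have D: "D = W + C - 2 * d"
    unfolding D_def W_def C_def d_def cmod_power2 inner_complex_def
    by (simp add: power2_eq_square algebra_simps)
  have "complex_of_real (1 + C) = 1 + c * cnj c"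
    by (simp only: C_def of_real_add of_real_1 complex_norm_square)
  hence "?h = (1 + cnj c * w) / (w - c)"
    using assms by (simp add: field_simps del: of_real_add)
  hence "(norm ?h)\<^sup>2 = (norm (1 + cnj c * w))\<^sup>2 / D"
    by (simp add: norm_divide power_divide D_def)
  also have "(norm (1 + cnj c * w))\<^sup>2 = 1 + 2 * d + W * C"
    unfolding W_def C_def d_def cmod_power2 inner_complex_def
    by (simp add: power2_eq_square algebra_simps)
  finally have H: "(norm ?h)\<^sup>2 = (1 + 2 * d + W * C) / D" .
  have "((norm ?h)\<^sup>2 - 1) / ((norm ?h)\<^sup>2 + 1) = (1 + 2 * d + W * C - D) / (1 + 2 * d + W * C + D)"
    using pos unfolding H by (simp add: divide_simps)
  \<comment> \<open>Substituting \<open>D = W + C - 2 * d\<close> cancels \<open>d\<close> in the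
    denominator, which then factors.\<close>
  also have "\<dots> = (4 * d + (W - 1) * (C - 1)) / ((1 + W) * (1 + C))"
    by (simp add: D algebra_simps)
  also have "\<dots> = inner (sphere_embed (Finite_pt w)) (sphere_embed (Finite_pt c))"
  proof -
    have "inner (complex_of_real (2 / (1 + W)) * w) (complex_of_real (2 / (1 + C)) * c)
        = 2 / (1 + W) * (2 / (1 + C)) * d"
      unfolding scaleR_conv_of_real[symmetric] d_def by simp
    thus ?thesis using pos
      by (simp add: inner_prod_def W_def[symmetric] C_def[symmetric] add_divide_distrib add.commute
          del: of_real_divide of_real_add)
  qed
  finally show ?thesis
    by (simp only: dist_Finite_Infinity C_def[symmetric]) (simp add: dist_riemann_sphere_def)
qed

text \<open>Conjugation preserves the height on the sphere. This is the case of the rotation at a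
  pole, where infinity goes to \<open>cnj c\<close>.\<close>

lemma dist_Infinity_Finite:
  "dist Infinity_pt (Finite_pt c) = dist (Finite_pt (cnj c)) Infinity_pt"
  by (simp add: dist_riemann_sphere_def)

section \<open>Reduction to a nonconstant entire function\<close>

lemma transcendental_imp_meromorphic_map:
  assumes "transcendental_entire f \<or> transcendental_meromorphic f"
  shows "meromorphic_map f" "\<not> rational_map f"
proof -
  have "meromorphic_map f" if "entire_map f"
  proof -
    obtain g where g: "g holomorphic_on UNIV" "\<And>z. f z = Finite_pt (g z)"
      using \<open>entire_map f\<close> by (auto simp: entire_map_def)
    have "g analytic_on UNIV" using g(1) by (simp add: analytic_on_open)
    moreover from this have "\<not> is_pole g z" for z
      using analytic_on_subset not_is_pole_holomorphic[of UNIV z g] g(1) by blast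
    ultimately show ?thesis
      unfolding meromorphic_map_def
      using analytic_on_imp_nicely_meromorphic_on g(2) by (intro exI[of _ g]) auto
  qed
  thus "meromorphic_map f" "\<not> rational_map f"
    using assms by (auto simp: transcendental_entire_def transcendental_meromorphic_def)
qed

lemma rational_map_const:
  assumes "\<And>z. f z = Finite_pt k"
  shows "rational_map f"
  unfolding rational_map_def
  by (rule exI[of _ "[:k:]"], rule exI[of _ 1]) (use assms in auto)

text \<open>Rotating \<open>a\<close> to infinity leaves a map that never takes the value infinity,
  hence an entire function; rotations preserve distance. If it were constant, \<open>f\<close> would
  be constant and so rational.\<close>

lemma omitted_value_entire_model:
  assumes mer: "meromorphic_map f" and nrat: "\<not> rational_map f" and om: "omitted_value f a"
  obtains h where "h holomorphic_on UNIV" "\<not> h constant_on UNIV"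
    "\<And>z. dist (f z) a = dist (Finite_pt (h z)) Infinity_pt"
proof -
  obtain g where g: "g nicely_meromorphic_on UNIV"
    and f: "\<And>z. f z = (if is_pole g z then Infinity_pt else Finite_pt (g z))"
    using mer by (auto simp: meromorphic_map_def)
  have gm: "g meromorphic_on UNIV" using g by (simp add: nicely_meromorphic_on_def)
  have an: "g analytic_on {z}" if "\<not> is_pole g z" for z
    using nicely_meromorphic_on_imp_analytic_at[OF g] that by simp
  show ?thesis
  proof (cases a)
    case Infinity_pt
    have np: "\<not> is_pole g z" for z
      using om f Infinity_pt unfolding omitted_value_def by metis
    have "g holomorphic_on UNIV"
      using an np analytic_on_analytic_at analytic_imp_holomorphic by blast
    moreover have "\<not> g constant_on UNIV"
    proof
      assume "g constant_on UNIV"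
      then obtain k where "g z = k" for z by (auto simp: constant_on_def)
      hence "f z = Finite_pt k" for z using f np by simp
      thus False using nrat rational_map_const by blast
    qed
    ultimately show ?thesis using that f np Infinity_pt by simp
  next
    case (Finite_pt c)
    define K where "K = complex_of_real (1 + (norm c)\<^sup>2)"
    have K: "K \<noteq> 0"
      unfolding K_def of_real_eq_0_iff by (smt (verit) zero_le_power2)
    \<comment> \<open>The value at a pole is the limit of the quotient formula there, so that
      \<open>h\<close> is continuous and the singularity is removed.\<close>
    define h where "h z = (if is_pole g z then cnj c else cnj c + K / (g z - c))" for z
    have gc: "g z \<noteq> c" if "\<not> is_pole g z" for z
      using om f that Finite_pt unfolding omitted_value_def by metis
    have evnp: "eventually (\<lambda>w. \<not> is_pole g w) (at z)" for z
      using gm by (metis UNIV_I eventually_not_pole meromorphic_onE)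
    have hev: "eventually (\<lambda>w. h w = cnj c + K / (g w - c)) (at z)" for z
      using evnp[of z] by eventually_elim (simp add: h_def)
    have "h analytic_on {z}" for z
    proof (rule meromorphic_at_isCont_imp_analytic)
      have "(\<lambda>w. cnj c + K / (g w - c)) meromorphic_on {z}"
        using meromorphic_on_subset[OF gm] by (intro meromorphic_intros) auto
      thus "h meromorphic_on {z}"
        using meromorphic_on_cong[of "{z}" h "\<lambda>w. cnj c + K / (g w - c)" "{z}"] hev by simp
      have "((\<lambda>w. cnj c + K / (g w - c)) \<longlongrightarrow> h z) (at z)"
      proof (cases "is_pole g z")
        case True
        hence "filterlim (\<lambda>w. g w - c) at_infinity (at z)"
          unfolding is_pole_def
          using tendsto_add_filterlim_at_infinity'[of g "at z" "\<lambda>_. - c" "- c"] by simp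
        hence "((\<lambda>w. cnj c + K / (g w - c)) \<longlongrightarrow> cnj c + 0) (at z)"
          by (intro tendsto_intros tendsto_divide_0[OF tendsto_const])
        thus ?thesis using True by (simp add: h_def)
      next
        case False
        hence "(g \<longlongrightarrow> g z) (at z)"
          using an analytic_at_imp_isCont isContD by blast
        thus ?thesis using False gc[OF False]
          by (auto simp: h_def intro!: tendsto_intros)
      qed
      thus "isCont h z"
        unfolding isCont_def using tendsto_cong[OF hev[of z]] by simp
    qed
    hence "h holomorphic_on UNIV"
      using analytic_on_analytic_at analytic_imp_holomorphic by blast
    moreover have "\<not> h constant_on UNIV"
    proof
      assume "h constant_on UNIV"
      then obtain k where k: "h z = k" for z by (auto simp: constant_on_def)
      obtain z0 where z0: "\<not> is_pole g z0"
        using eventually_happens[OF evnp[of 0]] by auto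
      \<comment> \<open>A point that is not a pole gives \<open>k\<close> a nonzero offset from
        \<open>cnj c\<close>, the value at poles. So there are no poles, and the formula can be
        solved for \<open>g\<close>.\<close>
      have "k \<noteq> cnj c"
        using k[of z0] z0 gc[OF z0] K by (auto simp: h_def)
      hence np: "\<not> is_pole g z" for z
        using k[of z] by (auto simp: h_def)
      have "g z = c + K / (k - cnj c)" for z
      proof -
        have "cnj c + K / (g z - c) = k" using k[of z] np[of z] by (simp add: h_def)
        hence "K / (g z - c) = k - cnj c" by (metis add_diff_cancel_left')
        thus ?thesis using gc[OF np[of z]] K \<open>k \<noteq> cnj c\<close> by (simp add: field_simps)
      qed
      hence "f z = Finite_pt (c + K / (k - cnj c))" for z
        using f np by simp
      thus False using nrat rational_map_const by blast
    qed
    moreover have "dist (f z) a = dist (Finite_pt (h z)) Infinity_pt" for z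
      using f[of z] dist_Infinity_Finite dist_Finite_eq_rotated[OF gc] Finite_pt
      by (auto simp: h_def K_def)
    ultimately show ?thesis using that by blast
  qed
qed

section \<open>Asymptotic values in the presence of a Baker omitted value\<close>

theorem theorem2p1:
  fixes f :: "complex \<Rightarrow> riemann_sphere" and a :: riemann_sphere
  assumes "transcendental_entire f \<or> transcendental_meromorphic f"
    and "baker_omitted_value f a"
  shows "asymptotic_value f a \<and> (\<forall>b. asymptotic_value f b \<longrightarrow> b = a)"
proof -
  have om: "omitted_value f a" using assms(2) by (simp add: baker_omitted_value_def)
  obtain r0 where r0: "r0 > 0" and
    bov: "\<And>r C. \<lbrakk>0 < r; r < r0; C \<in> components (frontier (f -` ball a r))\<rbrakk> \<Longrightarrow> bounded C"
    using assms(2) by (auto simp: baker_omitted_value_def)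
  obtain h where h: "h holomorphic_on UNIV" "\<not> h constant_on UNIV"
    and dist_h: "\<And>z. dist (f z) a = dist (Finite_pt (h z)) Infinity_pt"
    using omitted_value_entire_model[OF transcendental_imp_meromorphic_map[OF assms(1)] om] by blast
  have cont: "continuous_on UNIV h"
    using h(1) holomorphic_on_imp_continuous_on by blast
  \<comment> \<open>Below \<open>r0\<close> boundary components are bounded; below \<open>pi\<close>
    discs about \<open>a\<close> pull back to superlevel sets of \<open>h\<close>.\<close>
  define m where "m = min r0 pi"
  have m: "m > 0" "m \<le> r0" "m \<le> pi" using r0 by (auto simp: m_def)
  define U where "U r = f -` ball a r" for r
  have U_level: "U r = {z. sqrt ((1 + cos r) / (1 - cos r)) < norm (h z)}" if "0 < r" "r < m" for r
    using dist_Infinity_less_iff[of r] that m(3)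
    by (simp only: U_def vimage_def mem_ball dist_commute[of a] dist_h)
  have U_frontier: "bounded C" if "0 < r" "r < m" "C \<in> components (frontier (U r))" for r C
    using bov[of r C] that m(2) unfolding U_def by simp
  have U_unb: "\<not> bounded V" if "0 < r" "r < m" "V \<in> components (U r)" for r V
    using superlevel_component_unbounded[OF h(1)] that(3) unfolding U_level[OF that(1,2)] by blast
  have U_ne: "U r \<noteq> {}" if "0 < r" "r < m" for r
    using superlevel_nonempty[OF h] unfolding U_level[OF that] by blast
  have U_open: "open (U r)" if "0 < r" "r < m" for r
    unfolding U_level[OF that]
    by (intro open_Collect_less continuous_intros continuous_on_subset[OF cont]) auto
  have U_conn: "connected (U r)" if "0 < r" "r < m" for r
    by (rule connected_if_components_unbounded) (use U_frontier U_unb that in auto)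

  have "asymptotic_value f a"
  proof -
    \<comment> \<open>The shift by 2 makes \<open>s 0\<close> strictly smaller than
      \<open>m\<close>.\<close>
    define s where "s n = m / real (n + 2)" for n
    have s: "0 < s n" "s n < m" for n
      using m by (auto simp: s_def field_simps intro!: add_pos_nonneg)
    have "decseq (\<lambda>n. U (s n))"
      unfolding decseq_def U_def
    proof (intro allI impI vimage_mono subset_ball)
      fix k n :: nat assume "k \<le> n"
      thus "s n \<le> s k" using m by (auto simp: s_def intro!: divide_left_mono)
    qed
    then obtain \<gamma> where \<gamma>: "continuous_on {0..} \<gamma>" "\<And>n t. real n \<le> t \<Longrightarrow> \<gamma> t \<in> U (s n)"
      using path_through_nested_open_sets[of "\<lambda>n. U (s n)"] U_open U_conn U_ne s by blast
    have s0: "s \<longlonglongrightarrow> 0"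
      unfolding s_def using LIMSEQ_ignore_initial_segment[OF lim_const_over_n[of m], of 2] by simp
    have small: "eventually (\<lambda>t. dist (f (\<gamma> t)) a < e) at_top" if "e > 0" for e
    proof -
      obtain n where n: "s n < e"
        using eventually_happens[OF order_tendstoD(2)[OF s0 \<open>e > 0\<close>]] by auto
      have "dist (f (\<gamma> t)) a < e" if "real n \<le> t" for t
        using \<gamma>(2)[OF that] n by (auto simp: U_def dist_commute)
      thus ?thesis using eventually_at_top_linorder by blast
    qed
    have "filterlim \<gamma> at_infinity at_top"
      unfolding filterlim_at_infinity[OF order_refl]
    proof (intro allI impI)
      fix B :: real
      have "compact (h ` cball 0 B)"
        by (intro compact_continuous_image continuous_on_subset[OF cont]) auto
      then obtain M where M: "\<And>z. norm z \<le> B \<Longrightarrow> norm (h z) \<le> M"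
        by (metis bounded_iff compact_imp_bounded image_eqI mem_cball_0)
      \<comment> \<open>A value of \<open>h\<close> closer to infinity than \<open>M\<close> has
        modulus above \<open>\<bar>M\<bar>\<close>, which cannot occur on the disc of radius
        \<open>B\<close>. So \<open>\<gamma>\<close> must leave every disc.\<close>
      define e where "e = dist (Finite_pt (of_real M)) Infinity_pt"
      have e: "e > 0" by (simp add: e_def)
      have "B \<le> norm (\<gamma> t)" if "dist (f (\<gamma> t)) a < e" for t
      proof (rule ccontr)
        assume "\<not> ?thesis"
        hence le: "norm (h (\<gamma> t)) \<le> \<bar>M\<bar>" using M[of "\<gamma> t"] by linarith
        define x y where "x = (norm (h (\<gamma> t)))\<^sup>2" and "y = M\<^sup>2"
        have xy: "0 \<le> x" "x \<le> y"
          using power_mono[OF le, of 2] by (auto simp: x_def y_def)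
        have "arccos ((y - 1) / (y + 1)) \<le> arccos ((x - 1) / (x + 1))"
          using xy by (intro arccos_le_arccos) (auto simp: field_simps)
        thus False using that
          by (simp add: dist_h e_def dist_Finite_Infinity x_def y_def)
      qed
      thus "eventually (\<lambda>t. B \<le> norm (\<gamma> t)) at_top"
        using small[OF e] by (auto elim: eventually_mono)
    qed
    moreover have "((\<lambda>t. f (\<gamma> t)) \<longlongrightarrow> a) at_top"
      using small by (simp add: tendsto_iff)
    ultimately show ?thesis using \<gamma>(1) by (auto simp: asymptotic_value_def)
  qed
  moreover have "b = a" if "asymptotic_value f b" for b
  proof (rule ccontr)
    assume "b \<noteq> a"
    \<comment> \<open>The halves make both bounds strict. Values near \<open>b\<close> then stay
      farther than \<open>r\<close> from \<open>a\<close>, so a tail of the curve avoids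
      \<open>U r\<close>.\<close>
    define r where "r = min (m / 2) (dist b a / 2)"
    have r: "0 < r" "r < m" "r < dist b a"
      using \<open>b \<noteq> a\<close> m by (auto simp: r_def min_less_iff_disj)
    obtain \<gamma> :: "real \<Rightarrow> complex" where \<gamma>: "continuous_on {0..} \<gamma>" "filterlim \<gamma> at_infinity at_top"
      "((\<lambda>t. f (\<gamma> t)) \<longlongrightarrow> b) at_top"
      using \<open>asymptotic_value f b\<close> unfolding asymptotic_value_def by blast
    have "eventually (\<lambda>t. r < dist (f (\<gamma> t)) a) at_top"
      using order_tendstoD(1)[OF tendsto_dist[OF \<gamma>(3) tendsto_const] r(3)] .
    then obtain t0 where t0: "\<And>t. t \<ge> t0 \<Longrightarrow> r < dist (f (\<gamma> t)) a"
      by (auto simp: eventually_at_top_linorder)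
    \<comment> \<open>The maximum with 0 keeps the tail where \<open>\<gamma>\<close> is continuous,
      so \<open>T\<close> is connected. Avoiding a component of \<open>U r\<close> makes
      \<open>T\<close> bounded, against \<open>\<gamma>\<close> tending to infinity.\<close>
    define T where "T = \<gamma> ` {max 0 t0..}"
    obtain V where V: "V \<in> components (U r)"
      using U_ne r components_eq_empty by blast
    have "connected T"
      unfolding T_def using \<gamma>(1)
      by (intro connected_continuous_image) (auto intro: continuous_on_subset)
    moreover have "T \<inter> U r = {}"
      using t0 by (force simp: T_def U_def dist_commute)
    ultimately have "bounded T"
      using connected_disjoint_unbounded_component_imp_bounded[of "U r" V T]
        U_frontier U_unb V r in_components_subset[OF V] by fastforce
    then obtain B where B: "\<And>t. t \<ge> max 0 t0 \<Longrightarrow> norm (\<gamma> t) \<le> B"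
      unfolding bounded_iff T_def by (metis atLeast_iff imageI)
    have "eventually (\<lambda>t. B + 1 \<le> norm (\<gamma> t)) at_top"
      using filterlim_at_infinity_imp_norm_at_top[OF \<gamma>(2)] by (simp add: filterlim_at_top)
    hence "eventually (\<lambda>t. B + 1 \<le> norm (\<gamma> t) \<and> max 0 t0 \<le> t) at_top"
      by (intro eventually_conj eventually_ge_at_top)
    then obtain t where "B + 1 \<le> norm (\<gamma> t)" "max 0 t0 \<le> t"
      using eventually_happens[of _ "at_top :: real filter"] by auto
    thus False using B[of t] by linarith
  qed
  ultimately show ?thesis by blast
qed

end
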